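(* For every $\epsilon>0$ there exists $m_\epsilon$ (depending only on $\epsilon$), and for every positive integer $j$ there exists a constant $c_{\epsilon,j}>0$ (depending only on $\epsilon$ and $j$), such that the following holds. Let $G=\mathbb{Z}^{r_0}\oplus\mathbb{Z}_{q_1}^{r_1}\oplus\cdots\oplus\mathbb{Z}_{q_k}^{r_k}$ be a finitely generated abelian group, where the $q_i$ are powers of (not necessarily distinct) primes, and let $\alpha$ be a positive integer. Let $G'=\mathbb{Z}_\alpha^{r_0}\oplus\mathbb{Z}_{q_1}^{r_1}\oplus\cdots\oplus\mathbb{Z}_{q_k}^{r_k}$, let $n=|G'|$, and suppose that $j$ is the number of elements of $G'$ of order at most $2$. Let $\mathcal S_m$ denote the collection of subsets of $\mathrm{Dih}(G_\alpha)$ of size $m$. If $m_\epsilon\le m\le c_{\epsilon,j}\sqrt n$, then the proportion of MSTD sets in $\mathcal S_m$ is at least $1-\epsilon$.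
   Context: For an abelian group $G$, $\mathrm{Dih}(G)=\mathbb{Z}_2\ltimes G$ is the generalized dihedral group, where the nonidentity element of $\mathbb{Z}_2$ acts on $G$ by inversion; its elements are written $(z,g)$ with $z\in\{0,1\}$, $g\in G$. Elements of $G$ are written as tuples $(g_{0,1},\dots,g_{0,r_0},g_{1,1},\dots,g_{k,r_k})$ with $g_{0,b}\in\mathbb{Z}$ and $g_{a,b}\in\mathbb{Z}_{q_a}$ for $a>0$. $\mathrm{Dih}(G_\alpha)$ is the finite subset $\{(z,(g_{0,1},\dots,g_{0,r_0},\dots,g_{k,r_k}))\in\mathrm{Dih}(G): 0\le g_{0,b}<\alpha \text{ for all } b\}$ of $\mathrm{Dih}(G)$; it has $2n$ elements. For a finite subset $A$ of $\mathrm{Dih}(G)$ (with products taken in $\mathrm{Dih}(G)$), $A+A=\{a_1a_2:a_1,a_2\in A\}$ and $A-A=\{a_1a_2^{-1}:a_1,a_2\in A\}$. $A$ is MSTD if $|A+A|>|A-A|$. The identity element counts among the elements of order at most $2$. *)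

theory Defs
  imports
    Complex_Main
    "HOL-Number_Theory.Prime_Powers"
    "HOL-Algebra.Coset"
    "HOL-Algebra.Multiplicative_Group"
    "HOL-Algebra.Product_Groups"
begin

text \<open>
  Elements of the direct sums below are tuples indexed by pairs \<open>(a, b)\<close> with
  \<open>0 \<le> a \<le> k\<close> and \<open>1 \<le> b \<le> r a\<close>. Any of \<open>k\<close>, \<open>r a\<close> may be \<open>0\<close>, and the orders
  \<open>q a\<close> need not be distinct.
\<close>

definition coord_index :: "nat \<Rightarrow> (nat \<Rightarrow> nat) \<Rightarrow> (nat \<times> nat) set" where
  "coord_index k r = (SIGMA a:{0..k}. {1..r a})"

text \<open>\<open>r 0\<close> copies of \<open>Z\<close> and \<open>r a\<close> copies of \<open>\<int>/(q a)\<int>\<close> for \<open>1 \<le> a \<le> k\<close>; the value \<open>q 0\<close> is not used.\<close>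

definition direct_sum ::
    "int monoid \<Rightarrow> nat \<Rightarrow> (nat \<Rightarrow> nat) \<Rightarrow> (nat \<Rightarrow> nat) \<Rightarrow> (nat \<times> nat \<Rightarrow> int) monoid" where
  "direct_sum Z k r q =
     product_group (coord_index k r) (\<lambda>(a, b). if a = 0 then Z else integer_mod_group (q a))"

definition fg_group ::
    "nat \<Rightarrow> (nat \<Rightarrow> nat) \<Rightarrow> (nat \<Rightarrow> nat) \<Rightarrow> (nat \<times> nat \<Rightarrow> int) monoid" where
  "fg_group k r q = direct_sum integer_group k r q"

text \<open>The finite group \<open>G'\<close>, in which the free part \<open>\<int>\<^bsup>r 0\<^esup>\<close> is replaced by \<open>\<int>\<^bsub>\<alpha>\<^esub>\<^bsup>r 0\<^esup>\<close>.\<close>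

definition reduced_group ::
    "nat \<Rightarrow> nat \<Rightarrow> (nat \<Rightarrow> nat) \<Rightarrow> (nat \<Rightarrow> nat) \<Rightarrow> (nat \<times> nat \<Rightarrow> int) monoid" where
  "reduced_group \<alpha> k r q = direct_sum (integer_mod_group \<alpha>) k r q"

text \<open>
  The semidirect product \<open>\<int>\<^sub>2 \<ltimes> G\<close> with the nonidentity element of \<open>\<int>\<^sub>2\<close> acting by
  inversion; in the product \<open>(z, g) (w, h)\<close> it is \<open>z\<close> that acts, on \<open>h\<close>.
\<close>

definition Dih :: "('a, 'b) monoid_scheme \<Rightarrow> (int \<times> 'a) monoid" where
  "Dih G =
     \<lparr>carrier = carrier (integer_mod_group 2) \<times> carrier G,
      monoid.mult = (\<lambda>(z, g) (w, h).
        (z \<otimes>\<^bsub>integer_mod_group 2\<^esub> w, g \<otimes>\<^bsub>G\<^esub> (if z = 0 then h else inv\<^bsub>G\<^esub> h))),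
      one = (\<one>\<^bsub>integer_mod_group 2\<^esub>, \<one>\<^bsub>G\<^esub>)\<rparr>"

definition Dih_box ::
    "nat \<Rightarrow> nat \<Rightarrow> (nat \<Rightarrow> nat) \<Rightarrow> (nat \<Rightarrow> nat) \<Rightarrow> (int \<times> (nat \<times> nat \<Rightarrow> int)) set" where
  "Dih_box \<alpha> k r q =
     {(z, g) \<in> carrier (Dih (fg_group k r q)). \<forall>b\<in>{1..r 0}. 0 \<le> g (0, b) \<and> g (0, b) < int \<alpha>}"

text \<open>\<open>A + A\<close> and \<open>A - A\<close> are \<open>A <#> A\<close> and \<open>A <#> set_inv A\<close> in the notation for cosets.\<close>

definition MSTD :: "('a, 'b) monoid_scheme \<Rightarrow> 'a set \<Rightarrow> bool" where
  "MSTD G A \<longleftrightarrow> card (A <#>\<^bsub>G\<^esub> A) > card (A <#>\<^bsub>G\<^esub> (set_inv\<^bsub>G\<^esub> A))"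

definition proportion :: "('a \<Rightarrow> bool) \<Rightarrow> 'a set \<Rightarrow> real" where
  "proportion P S = real (card {x \<in> S. P x}) / real (card S)"

lemma comm_group_direct_sum:
  assumes "comm_group Z"
  shows "comm_group (direct_sum Z k r q)"
proof -
  have mod: "comm_group (integer_mod_group n)" for n
    using group_integer_mod_group
    by (rule group.group_comm_groupI) (auto simp: integer_mod_group_def integer_group_def add.commute)
  let ?F = "\<lambda>(a::nat, b::nat). if a = 0 then Z else integer_mod_group (q a)"
  have comm: "comm_group (?F i)" for i
    using assms mod by (cases i) simp
  have "group (product_group (coord_index k r) ?F)"
    using comm comm_group.axioms(2) by (intro product_group) blast
  then show ?thesis
    unfolding direct_sum_def
  proof (rule group.group_comm_groupI)
    fix x y
    assume "x \<in> carrier (product_group (coord_index k r) ?F)"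
      and "y \<in> carrier (product_group (coord_index k r) ?F)"
    then have "x i \<otimes>\<^bsub>?F i\<^esub> y i = y i \<otimes>\<^bsub>?F i\<^esub> x i" if "i \<in> coord_index k r" for i
      using that comm_monoid.m_comm[OF comm_group.axioms(1)[OF comm]] by (simp only: carrier_product_group PiE_iff)
    then show "x \<otimes>\<^bsub>product_group (coord_index k r) ?F\<^esub> y = y \<otimes>\<^bsub>product_group (coord_index k r) ?F\<^esub> x"
      unfolding mult_product_group by (rule restrict_ext)
  qed
qed

lemma group_Dih:
  assumes "comm_group G"
  shows "group (Dih G)"
proof -
  interpret comm_group G by fact
  show ?thesis
  proof (rule groupI)
    show "\<And>x y. \<lbrakk>x \<in> carrier (Dih G); y \<in> carrier (Dih G)\<rbrakk> \<Longrightarrow> x \<otimes>\<^bsub>Dih G\<^esub> y \<in> carrier (Dih G)"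
      by (auto simp: Dih_def integer_mod_group_def)
    show "\<one>\<^bsub>Dih G\<^esub> \<in> carrier (Dih G)"
      by (auto simp: Dih_def integer_mod_group_def)
    fix x assume x: "x \<in> carrier (Dih G)"
    then show "\<one>\<^bsub>Dih G\<^esub> \<otimes>\<^bsub>Dih G\<^esub> x = x"
      by (auto simp: Dih_def integer_mod_group_def)
    obtain z g where zg: "x = (z, g)" "g \<in> carrier G" "z = 0 \<or> z = 1"
      using x by (cases x) (force simp: Dih_def integer_mod_group_def)
    then show "\<exists>y\<in>carrier (Dih G). y \<otimes>\<^bsub>Dih G\<^esub> x = \<one>\<^bsub>Dih G\<^esub>"
      by (intro bexI[of _ "(z, if z = 0 then inv\<^bsub>G\<^esub> g else g)"])
         (auto simp: Dih_def integer_mod_group_def)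
    fix y w assume "y \<in> carrier (Dih G)" "w \<in> carrier (Dih G)"
    then obtain u h v l where "y = (u, h)" "h \<in> carrier G" "u = 0 \<or> u = 1"
        "w = (v, l)" "l \<in> carrier G" "v = 0 \<or> v = 1"
      by (cases y; cases w) (force simp: Dih_def integer_mod_group_def)
    with zg show "x \<otimes>\<^bsub>Dih G\<^esub> y \<otimes>\<^bsub>Dih G\<^esub> w = x \<otimes>\<^bsub>Dih G\<^esub> (y \<otimes>\<^bsub>Dih G\<^esub> w)"
      by (elim disjE) (simp_all add: Dih_def integer_mod_group_def m_assoc inv_mult)
  qed
qed

end

theory Submission
  imports Defs
begin

text \<open>
  Let \<open>A\<close> consist of the rotations \<open>(0, x)\<close> with \<open>x \<in> R\<close> and the flips \<open>(1, a)\<close> with \<open>a \<in> F\<close>, and put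
  \<open>r = |R|\<close>, \<open>f = |F|\<close>, \<open>r + f = m\<close>. Writing the abelian group additively, the rotations in \<open>A + A\<close> are
  \<open>(R + R) \<union> (F - F)\<close> and its flips are \<open>(R + F) \<union> (F - R)\<close>. A flip is its own inverse, so the
  rotations in \<open>A - A\<close> are \<open>(R - R) \<union> (F - F)\<close>, but its flips are only \<open>R + F\<close>. Hence the sumset
  gains \<open>F - R\<close>, generically of size \<open>r f\<close>, and \<open>R + R\<close>, generically of size about \<open>r\<^sup>2 / 2\<close>, while the
  difference set gains \<open>R - R\<close>, of size at most \<open>r\<^sup>2 - r + 1\<close>. When \<open>r\<close> and \<open>f\<close> are both close to \<open>m / 2\<close>
  the balance \<open>r f - r\<^sup>2 / 2\<close> is at least a positive constant times \<open>m\<^sup>2\<close>.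

  The generic sizes fail only through additive coincidences: \<open>a - x = b - y\<close>, \<open>x + y = x' + y'\<close>, and
  \<open>x + y = a - b\<close>, where \<open>x, y, x', y'\<close> lie in \<open>R\<close> and \<open>a, b\<close> in \<open>F\<close>. Each coincidence costs at most a
  bounded number of elements (\<open>Dih_sums_vs_differences\<close>), and since only lower bounds for the two
  gains of the sumset and an upper bound for the gain of the difference set are needed, no exact
  sizes have to be computed.

  For a random \<open>A\<close> of size \<open>m\<close> in a box with \<open>2 n\<close> elements, a fixed set of \<open>t\<close> elements lies in \<open>A\<close> with
  probability at most \<open>(m / 2 n)\<^sup>t\<close>. There are at most \<open>n\<^sup>3\<close> coincidences among four distinct elements,
  \<open>n\<^sup>2\<close> of each kind among three, and \<open>n\<close> times the number of solutions of \<open>x + x = 0\<close> among two. For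
  \<open>m \<le> c \<surd>n\<close> the expected number of coincidences is therefore at most of order \<open>j c\<^sup>2 m\<^sup>2\<close>
  (\<open>expected_coincidences_le\<close>), so by Markov's inequality it rarely reaches the \<open>m\<^sup>2\<close> scale when \<open>j c\<^sup>2\<close>
  is small. The difference \<open>r - f\<close> has second moment at most \<open>m\<close> (\<open>sum_square_le\<close>), so by Chebyshev's
  inequality it rarely exceeds \<open>m / 4\<close> when \<open>m\<close> is large. The first smallness fixes \<open>c\<close> in terms of
  \<open>\<epsilon>\<close> and \<open>j\<close>, the second fixes the lower bound on \<open>m\<close> in terms of \<open>\<epsilon>\<close> alone.
\<close>

section \<open>Uniformly random subsets of a given size\<close>

definition subsets_of_size :: "'a set \<Rightarrow> nat \<Rightarrow> 'a set set" where
  "subsets_of_size B m = {A. A \<subseteq> B \<and> card A = m}"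

lemma finite_subsets_of_size: "finite B \<Longrightarrow> finite (subsets_of_size B m)"
  by (simp add: subsets_of_size_def)

lemma card_subsets_of_size: "finite B \<Longrightarrow> card (subsets_of_size B m) = card B choose m"
  by (simp add: subsets_of_size_def n_subsets)

lemma card_subsets_containing:
  assumes "finite B" "U \<subseteq> B"
  shows "card {A \<in> subsets_of_size B m. U \<subseteq> A} =
    (if card U \<le> m then (card B - card U) choose (m - card U) else 0)"
proof (cases "card U \<le> m")
  case True
  have finU: "finite U"
    using assms finite_subset by blast
  have "bij_betw (\<lambda>A. A - U) {A \<in> subsets_of_size B m. U \<subseteq> A}
      (subsets_of_size (B - U) (m - card U))"
  proof (rule bij_betw_byWitness[where f' = "\<lambda>A. A \<union> U"])
    show "(\<lambda>A. A - U) ` {A \<in> subsets_of_size B m. U \<subseteq> A}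
        \<subseteq> subsets_of_size (B - U) (m - card U)"
      using finU by (auto simp: subsets_of_size_def card_Diff_subset)
    show "(\<lambda>A. A \<union> U) ` subsets_of_size (B - U) (m - card U)
        \<subseteq> {A \<in> subsets_of_size B m. U \<subseteq> A}"
    proof clarify
      fix A assume "A \<in> subsets_of_size (B - U) (m - card U)"
      then have "A \<subseteq> B" "A \<inter> U = {}" "card A = m - card U"
        by (auto simp: subsets_of_size_def)
      moreover from this have "finite A"
        using assms finite_subset by blast
      ultimately show "A \<union> U \<in> subsets_of_size B m \<and> U \<subseteq> A \<union> U"
        using finU assms True by (auto simp: subsets_of_size_def card_Un_disjoint)
    qed
  qed (auto simp: subsets_of_size_def)
  then show ?thesis
    using assms True finU
    by (simp add: bij_betw_same_card card_subsets_of_size card_Diff_subset)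
next
  case False
  have "\<not> U \<subseteq> A" if "A \<in> subsets_of_size B m" for A
    using that False assms finite_subset[of A B] card_mono[of A U]
    by (auto simp: subsets_of_size_def)
  then have none: "{A \<in> subsets_of_size B m. U \<subseteq> A} = {}"
    by blast
  show ?thesis
    unfolding none using False by simp
qed

text \<open>
  The left side divided by \<open>N choose m\<close> is the product of the factors \<open>(m - i) / (N - i)\<close> for \<open>i < t\<close>,
  and each of them is at most \<open>m / N\<close> because \<open>m \<le> N\<close>.
\<close>

lemma binomial_shift_le:
  assumes "t \<le> m" "m \<le> N"
  shows "real ((N - t) choose (m - t)) \<le> (real m / real N) ^ t * real (N choose m)"
  using assms(1)
proof (induction t)
  case (Suc t)
  have "Suc (m - Suc t) * ((N - t) choose Suc (m - Suc t)) =
      (N - t) * ((N - t - 1) choose (m - Suc t))"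
    by (rule binomial_absorption)
  moreover have "Suc (m - Suc t) = m - t" "N - t - 1 = N - Suc t"
    using Suc.prems by auto
  ultimately have "(m - t) * ((N - t) choose (m - t)) = (N - t) * ((N - Suc t) choose (m - Suc t))"
    by simp
  then have eq: "real (m - t) * real ((N - t) choose (m - t)) =
      real (N - t) * real ((N - Suc t) choose (m - Suc t))"
    by (metis of_nat_mult)
  have pos: "0 < real (N - t)" "0 < real N"
    using Suc.prems assms by auto
  have "real (m - t) / real (N - t) \<le> real m / real N"
    using Suc.prems assms pos
    by (auto simp: divide_simps of_nat_diff algebra_simps intro!: mult_right_mono)
  moreover have "real ((N - Suc t) choose (m - Suc t)) =
      real (m - t) / real (N - t) * real ((N - t) choose (m - t))"
    using eq pos by (simp add: field_simps)
  ultimately have "real ((N - Suc t) choose (m - Suc t)) \<le>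
      real m / real N * real ((N - t) choose (m - t))"
    by (simp only: mult_right_mono of_nat_0_le_iff)
  also have "\<dots> \<le> real m / real N * ((real m / real N) ^ t * real (N choose m))"
    using Suc by (intro mult_left_mono) auto
  finally show ?case
    by (simp add: mult.assoc)
qed simp

lemma card_subsets_containing_le:
  assumes "finite B" "U \<subseteq> B" "m \<le> card B"
  shows "real (card {A \<in> subsets_of_size B m. U \<subseteq> A}) \<le>
    (real m / real (card B)) ^ card U * real (card B choose m)"
  using assms binomial_shift_le[of "card U" m "card B"]
  by (auto simp: card_subsets_containing)

text \<open>
  Linearity of expectation, with both sides multiplied by the number of subsets: \<open>I\<close> indexes
  configurations, and configuration \<open>i\<close> occurs in \<open>A\<close> when its \<open>t\<close> elements \<open>U i\<close> all lie in \<open>A\<close>.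
\<close>

lemma expected_configurations_le:
  assumes "finite B" "m \<le> card B" "finite I"
    and "\<And>i. i \<in> I \<Longrightarrow> U i \<subseteq> B \<and> card (U i) = t"
  shows "(\<Sum>A\<in>subsets_of_size B m. real (card {i \<in> I. U i \<subseteq> A})) \<le>
    real (card I) * (real m / real (card B)) ^ t * real (card B choose m)"
proof -
  let ?S = "subsets_of_size B m"
  have fin: "finite ?S"
    using assms finite_subsets_of_size by blast
  have "(\<Sum>A\<in>?S. real (card {i \<in> I. U i \<subseteq> A})) = (\<Sum>A\<in>?S. \<Sum>i\<in>I. of_bool (U i \<subseteq> A))"
    using assms by (simp add: sum.If_cases of_bool_def Int_def)
  also have "\<dots> = (\<Sum>i\<in>I. \<Sum>A\<in>?S. of_bool (U i \<subseteq> A))"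
    by (rule sum.swap)
  also have "\<dots> = (\<Sum>i\<in>I. real (card {A \<in> ?S. U i \<subseteq> A}))"
    using fin by (simp add: sum.If_cases of_bool_def Int_def)
  also have "\<dots> \<le> (\<Sum>i\<in>I. (real m / real (card B)) ^ t * real (card B choose m))"
  proof (intro sum_mono)
    fix i assume "i \<in> I"
    then show "real (card {A \<in> ?S. U i \<subseteq> A}) \<le>
        (real m / real (card B)) ^ t * real (card B choose m)"
      using card_subsets_containing_le[of B "U i" m] assms by auto
  qed
  finally show ?thesis
    by (simp add: mult.assoc)
qed

text \<open>
  Expand the square and count, for each pair of elements, the subsets containing it; \<open>K t\<close> is the
  number of subsets that contain \<open>t\<close> given elements. The diagonal contributes \<open>|B| K 1\<close>. Because the
  signs sum to zero, the products \<open>s a s b\<close> over \<open>a \<noteq> b\<close> sum to \<open>- |B|\<close>, so the rest contributes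
  \<open>- |B| K 2\<close> and may be dropped.
\<close>

lemma sum_square_le:
  fixes s :: "'a \<Rightarrow> real"
  assumes "finite B" "m \<le> card B" "B \<noteq> {}"
    and sign: "\<And>x. x \<in> B \<Longrightarrow> s x * s x = 1" and balanced: "sum s B = 0"
  shows "(\<Sum>A\<in>subsets_of_size B m. (sum s A)\<^sup>2) \<le> real m * real (card B choose m)"
proof -
  let ?S = "subsets_of_size B m"
  have fin: "finite ?S"
    using assms finite_subsets_of_size by blast
  define K where "K t = (if t \<le> m then real ((card B - t) choose (m - t)) else 0)" for t
  have K: "(\<Sum>A\<in>?S. of_bool ({a, b} \<subseteq> A)) = K (card {a, b})" if "a \<in> B" "b \<in> B" for a b
  proof -
    have "(\<Sum>A\<in>?S. of_bool ({a, b} \<subseteq> A)) = real (card {A \<in> ?S. {a, b} \<subseteq> A})"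
      using fin by (simp only: sum.If_cases of_bool_def) (simp add: Int_def)
    then show ?thesis
      using that assms(1) unfolding K_def by (subst (asm) card_subsets_containing) auto
  qed
  have square: "(sum s A)\<^sup>2 = (\<Sum>a\<in>B. \<Sum>b\<in>B. s a * s b * of_bool ({a, b} \<subseteq> A))" if "A \<in> ?S" for A
  proof -
    have "A \<subseteq> B"
      using that by (simp add: subsets_of_size_def)
    then have eq: "sum s A = (\<Sum>a\<in>B. s a * of_bool (a \<in> A))"
      using assms(1) by (simp add: sum.inter_restrict[symmetric] of_bool_def if_distrib
        Int_absorb1 cong: if_cong)
    show ?thesis
      unfolding eq power2_eq_square sum_product by (intro sum.cong) auto
  qed
  have "(\<Sum>A\<in>?S. (sum s A)\<^sup>2) = (\<Sum>A\<in>?S. \<Sum>a\<in>B. \<Sum>b\<in>B. s a * s b * of_bool ({a, b} \<subseteq> A))"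
    using square by simp
  also have "\<dots> = (\<Sum>a\<in>B. \<Sum>b\<in>B. \<Sum>A\<in>?S. s a * s b * of_bool ({a, b} \<subseteq> A))"
    by (subst sum.swap) (intro sum.cong refl sum.swap)
  also have "\<dots> = (\<Sum>a\<in>B. \<Sum>b\<in>B. s a * s b * K (card {a, b}))"
    using K by (intro sum.cong refl) (simp only: sum_distrib_left[symmetric])
  also have "\<dots> = (\<Sum>a\<in>B. K 1 - K 2)"
  proof (intro sum.cong refl)
    fix a assume a: "a \<in> B"
    have "(\<Sum>b\<in>B. s a * s b * K (card {a, b})) =
        s a * s a * K 1 + (\<Sum>b\<in>B - {a}. s a * s b * K 2)"
    proof -
      have "(\<Sum>b\<in>B - {a}. s a * s b * K (card {a, b})) = (\<Sum>b\<in>B - {a}. s a * s b * K 2)"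
      proof (rule sum.cong)
        fix b assume "b \<in> B - {a}"
        then have "card {a, b} = 2"
          by (simp add: card_2_iff doubleton_eq_iff) blast
        then show "s a * s b * K (card {a, b}) = s a * s b * K 2"
          by (simp only:)
      qed simp
      then show ?thesis
        using a assms(1) by (subst sum.remove[of B a]) simp_all
    qed
    also have "(\<Sum>b\<in>B - {a}. s a * s b * K 2) = s a * K 2 * (sum s B - s a)"
    proof -
      have "sum s (B - {a}) = sum s B - s a"
        using a assms(1) by (simp add: sum_diff1)
      then show ?thesis
        by (simp add: sum_distrib_left mult_ac flip: \<open>sum s (B - {a}) = sum s B - s a\<close>)
    qed
    also have "s a * s a * K 1 + s a * K 2 * (sum s B - s a) = K 1 - K 2"
    proof -
      have "s a * s a * K 1 + s a * K 2 * (sum s B - s a) = (s a * s a) * (K 1 - K 2)"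
        by (simp add: balanced algebra_simps)
      then show ?thesis
        by (simp only: sign[OF a] mult_1)
    qed
    finally show "(\<Sum>b\<in>B. s a * s b * K (card {a, b})) = K 1 - K 2" .
  qed
  also have "\<dots> \<le> real (card B) * K 1"
    by (simp add: K_def mult_left_mono)
  also have "K 1 \<le> real m / real (card B) * real (card B choose m)"
    using binomial_shift_le[of 1 m "card B"] assms by (auto simp: K_def)
  finally show ?thesis
    using assms by (simp add: mult_left_mono card_gt_0_iff)
qed

lemma markov_count:
  fixes X :: "'a \<Rightarrow> real"
  assumes "finite S" "\<And>A. A \<in> S \<Longrightarrow> X A \<ge> 0"
  shows "t * real (card {A \<in> S. t \<le> X A}) \<le> (\<Sum>A\<in>S. X A)"
proof -
  have "t * real (card {A \<in> S. t \<le> X A}) \<le> (\<Sum>A\<in>{A \<in> S. t \<le> X A}. X A)"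
    using sum_mono[of "{A \<in> S. t \<le> X A}" "\<lambda>_. t" X] by (simp add: mult.commute)
  also have "\<dots> \<le> (\<Sum>A\<in>S. X A)"
    using assms by (intro sum_mono2) auto
  finally show ?thesis .
qed

section \<open>Collisions and the size of an image\<close>

text \<open>
  After deleting from \<open>P\<close> one element for each pair that collides under \<open>f\<close> and for each pair whose
  \<open>f\<close>-value is hit by \<open>g\<close>, the map \<open>f\<close> is injective on the rest and avoids the image of \<open>g\<close>.
\<close>

lemma card_image_diff_ge:
  assumes "finite P" "finite Q"
  shows "card P \<le> card (f ` P - g ` Q) + card {(x, y). x \<in> P \<and> y \<in> P \<and> x \<noteq> y \<and> f x = f y}
    + card {(x, y). x \<in> P \<and> y \<in> Q \<and> f x = g y}"
    (is "_ \<le> _ + card ?C + card ?D")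
proof -
  let ?P0 = "P - fst ` ?C - fst ` ?D"
  have fin: "finite ?C" "finite ?D"
    using assms by (auto intro: finite_subset[of _ "P \<times> P"] finite_subset[of _ "P \<times> Q"])
  have "inj_on f ?P0"
    by (rule inj_onI) (force simp: image_iff)
  moreover have "f ` ?P0 \<subseteq> f ` P - g ` Q"
    by (force simp: image_iff)
  ultimately have "card ?P0 \<le> card (f ` P - g ` Q)"
    using assms by (intro card_inj_on_le) auto
  moreover have "card P \<le> card ?P0 + card (fst ` ?C \<union> fst ` ?D)"
  proof -
    have "card P \<le> card (?P0 \<union> (fst ` ?C \<union> fst ` ?D))"
      using assms fin by (intro card_mono) auto
    then show ?thesis
      using card_Un_le order_trans by blast
  qed
  moreover have "card (fst ` ?C \<union> fst ` ?D) \<le> card ?C + card ?D"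
    using card_Un_le[of "fst ` ?C" "fst ` ?D"] card_image_le[OF fin(1), of fst]
      card_image_le[OF fin(2), of fst] by linarith
  ultimately show ?thesis
    by linarith
qed

lemma card_offdiagonal:
  assumes "finite R"
  shows "card {(x, y). x \<in> R \<and> y \<in> R \<and> x \<noteq> y} + card R = card R * card R"
proof -
  let ?O = "{(x, y). x \<in> R \<and> y \<in> R \<and> x \<noteq> y}" and ?D = "(\<lambda>x. (x, x)) ` R"
  have "finite ?O"
    by (rule finite_subset[of _ "R \<times> R"]) (use assms in auto)
  then have "card (?O \<union> ?D) = card ?O + card ?D"
    using assms by (intro card_Un_disjoint) auto
  moreover have "?O \<union> ?D = R \<times> R"
    by auto
  moreover have "card ?D = card R"
    by (intro card_image inj_onI) simp
  ultimately show ?thesis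
    by (simp add: card_cartesian_product)
qed

text \<open>
  Since \<open>x + y = y + x\<close>, sums are counted without repetition only if each unordered pair of distinct
  elements is represented by one ordered pair.
\<close>

lemma half_of_offdiagonal:
  assumes "finite R"
  obtains P where "P \<subseteq> R \<times> R" "\<And>x y. (x, y) \<in> P \<Longrightarrow> (y, x) \<notin> P"
    "2 * card P + card R = card R * card R"
proof -
  \<comment> \<open>An injection into the naturals stands in for a linear order on \<open>R\<close>.\<close>
  obtain h :: "'a \<Rightarrow> nat" where h: "inj_on h R"
    using finite_imp_inj_to_nat_seg[OF assms] by auto
  let ?P = "{(x, y). x \<in> R \<and> y \<in> R \<and> h x < h y}"
  have fin: "finite ?P"
    by (rule finite_subset[of _ "R \<times> R"]) (use assms in auto)
  have "{(x, y). x \<in> R \<and> y \<in> R \<and> x \<noteq> y} = ?P \<union> prod.swap ` ?P"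
    using h by (force simp: inj_on_def image_iff)
  moreover have "card (prod.swap ` ?P) = card ?P"
    by (intro card_image inj_onI) auto
  moreover have "?P \<inter> prod.swap ` ?P = {}"
    by auto
  ultimately have "2 * card ?P + card R = card R * card R"
    using card_offdiagonal[OF assms] card_Un_disjoint[OF fin finite_imageI[OF fin]] by auto
  then show ?thesis
    by (intro that[of ?P]) auto
qed

section \<open>Sums and differences in a generalized dihedral group\<close>

definition rotations :: "(int \<times> 'a) set \<Rightarrow> 'a set" where
  "rotations A = {g. (0, g) \<in> A}"

definition flips :: "(int \<times> 'a) set \<Rightarrow> 'a set" where
  "flips A = {g. (1, g) \<in> A}"

lemma slices_as_images:
  "rotations A = snd ` {p \<in> A. fst p = 0}" "flips A = snd ` {p \<in> A. fst p = 1}"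
  by (force simp: rotations_def flips_def)+

text \<open>
  The three kinds of additive coincidences. The equations are cleared of inverses: the first says
  \<open>a - x = b - y\<close>, the second \<open>x + y = a - b\<close>. In both of these \<open>x\<close> and \<open>y\<close> are rotations and \<open>a\<close> and \<open>b\<close>
  are flips, so that a quadruple involves the elements \<open>(0, x)\<close>, \<open>(0, y)\<close>, \<open>(1, a)\<close>, \<open>(1, b)\<close>; in the
  third all four are rotations.
\<close>

definition parallel_pairs :: "('a, 'b) monoid_scheme \<Rightarrow> 'a set \<Rightarrow> 'a set \<Rightarrow> ('a \<times> 'a \<times> 'a \<times> 'a) set" where
  "parallel_pairs G R F = {(x, y, a, b). x \<in> R \<and> y \<in> R \<and> a \<in> F \<and> b \<in> F \<and>
     x \<noteq> y \<and> a \<noteq> b \<and> a \<otimes>\<^bsub>G\<^esub> y = b \<otimes>\<^bsub>G\<^esub> x}"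

definition sums_as_differences ::
    "('a, 'b) monoid_scheme \<Rightarrow> 'a set \<Rightarrow> 'a set \<Rightarrow> ('a \<times> 'a \<times> 'a \<times> 'a) set" where
  "sums_as_differences G R F = {(x, y, a, b). x \<in> R \<and> y \<in> R \<and> a \<in> F \<and> b \<in> F \<and>
     x \<otimes>\<^bsub>G\<^esub> y \<otimes>\<^bsub>G\<^esub> b = a}"

definition repeated_sums :: "('a, 'b) monoid_scheme \<Rightarrow> 'a set \<Rightarrow> ('a \<times> 'a \<times> 'a \<times> 'a) set" where
  "repeated_sums G R = {(x, y, a, b). x \<in> R \<and> y \<in> R \<and> a \<in> R \<and> b \<in> R \<and>
     distinct [x, y, a, b] \<and> x \<otimes>\<^bsub>G\<^esub> y = a \<otimes>\<^bsub>G\<^esub> b}"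

lemma finite_quadruples:
  assumes "finite R" "finite F"
  shows "finite (parallel_pairs G R F)" "finite (sums_as_differences G R F)"
    "finite (repeated_sums G R)"
proof -
  show "finite (parallel_pairs G R F)"
    by (rule finite_subset[of _ "R \<times> R \<times> F \<times> F"])
      (use assms in \<open>auto simp: parallel_pairs_def\<close>)
  show "finite (sums_as_differences G R F)"
    by (rule finite_subset[of _ "R \<times> R \<times> F \<times> F"])
      (use assms in \<open>auto simp: sums_as_differences_def\<close>)
  show "finite (repeated_sums G R)"
    by (rule finite_subset[of _ "R \<times> R \<times> R \<times> R"])
      (use assms in \<open>auto simp: repeated_sums_def\<close>)
qed

lemma card_slices:
  assumes "A \<subseteq> {0, 1} \<times> H" "finite A"
  shows "card A = card (rotations A) + card (flips A)"
    and "(\<Sum>p\<in>A. if fst p = 0 then 1 else -1) = real (card (rotations A)) - real (card (flips A))"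
proof -
  have R: "card (rotations A) = card {p \<in> A. fst p = 0}" for A :: "(int \<times> 'a) set"
    unfolding slices_as_images by (intro card_image inj_onI) (auto simp: prod_eq_iff)
  have F: "card (flips A) = card {p \<in> A. fst p = 1}" for A :: "(int \<times> 'a) set"
    unfolding slices_as_images by (intro card_image inj_onI) (auto simp: prod_eq_iff)
  have "card ({p \<in> A. fst p = 0} \<union> {p \<in> A. fst p = 1}) =
      card {p \<in> A. fst p = 0} + card {p \<in> A. fst p = 1}"
    using assms(2) by (intro card_Un_disjoint) auto
  moreover have "{p \<in> A. fst p = 0} \<union> {p \<in> A. fst p = 1} = A"
    using assms(1) by auto
  ultimately show "card A = card (rotations A) + card (flips A)"
    unfolding R F by simp
  have "{p \<in> A. fst p \<noteq> 0} = {p \<in> A. fst p = 1}"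
    using assms(1) by auto
  then show "(\<Sum>p\<in>A. if fst p = 0 then 1 else -1) = real (card (rotations A)) - real (card (flips A))"
    unfolding R F using assms(2) by (simp add: sum.If_cases Int_def)
qed

lemma card_filter_Un4_le:
  "card {i \<in> X \<union> Y \<union> Z \<union> W. P i} \<le>
    card {i \<in> X. P i} + card {i \<in> Y. P i} + card {i \<in> Z. P i} + card {i \<in> W. P i}"
proof -
  have eq: "{i \<in> X \<union> Y \<union> Z \<union> W. P i} = {i \<in> X. P i} \<union> {i \<in> Y. P i} \<union> {i \<in> Z. P i} \<union> {i \<in> W. P i}"
    by blast
  have "card (A \<union> B \<union> C \<union> D) \<le> card A + card B + card C + card D" for A B C D :: "'a set"
    using card_Un_le[of "A \<union> B \<union> C" D] card_Un_le[of "A \<union> B" C] card_Un_le[of A B] by linarith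
  then show ?thesis
    unfolding eq .
qed

context comm_group
begin

lemma left_cancel:
  assumes "x \<in> carrier G" "y \<in> carrier G" "z \<in> carrier G"
  shows "x \<otimes> y = x \<otimes> z \<longleftrightarrow> y = z"
  using assms by (simp add: Units_eq)

text \<open>
  The asymmetry behind the whole argument: inverting \<open>A\<close> negates \<open>R\<close> but fixes the flips. Therefore the
  products of a flip with an inverted rotation fall back into \<open>R + F\<close>, and the set \<open>F - R\<close> is lost.
\<close>

lemma Dih_set_mult:
  assumes "A \<subseteq> carrier (Dih G)"
  defines "R \<equiv> rotations A" and "F \<equiv> flips A"
  shows "A <#>\<^bsub>Dih G\<^esub> A =
      {0} \<times> ((R <#> R) \<union> (F <#> set_inv F)) \<union> {1} \<times> ((R <#> F) \<union> (F <#> set_inv R))"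
    and "A <#>\<^bsub>Dih G\<^esub> set_inv\<^bsub>Dih G\<^esub> A =
      {0} \<times> ((R <#> set_inv R) \<union> (F <#> set_inv F)) \<union> {1} \<times> (R <#> F)"
proof -
  have A: "A = {0} \<times> R \<union> {1} \<times> F"
  proof -
    have "z = 0 \<or> z = 1" if "(z, g) \<in> A" for z g
    proof -
      have "z \<in> {0..<2}"
        using that assms(1) by (auto simp: Dih_def carrier_integer_mod_group)
      then show ?thesis
        by auto
    qed
    then show ?thesis
      by (fastforce simp: R_def F_def rotations_def flips_def)
  qed
  have sub: "R \<subseteq> carrier G" "F \<subseteq> carrier G"
    using assms(1) by (auto simp: R_def F_def rotations_def flips_def Dih_def)
  have mult: "(0, g) \<otimes>\<^bsub>Dih G\<^esub> (w, h) = (w mod 2, g \<otimes> h)"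
    "(1, g) \<otimes>\<^bsub>Dih G\<^esub> (w, h) = ((1 + w) mod 2, g \<otimes> inv h)" for g h w
    by (auto simp: Dih_def)
  have inv0: "inv\<^bsub>Dih G\<^esub> (0, g) = (0, inv g)" and inv1: "inv\<^bsub>Dih G\<^esub> (1, g) = (1, g)"
    if "g \<in> carrier G" for g
    using that by (auto intro!: group.inv_equality[OF group_Dih[OF comm_group_axioms]]
      simp: mult) (auto simp: Dih_def carrier_integer_mod_group)
  have image_inv: "set_inv\<^bsub>K\<^esub> X = (\<lambda>x. inv\<^bsub>K\<^esub> x) ` X" for K :: "('c, 'd) monoid_scheme" and X
    by (auto simp: SET_INV_def)
  have "(\<lambda>x. inv\<^bsub>Dih G\<^esub> x) ` ({0} \<times> R) = {0} \<times> (\<lambda>x. inv x) ` R"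
  proof -
    have "(\<lambda>x. inv\<^bsub>Dih G\<^esub> x) ` Pair 0 ` R = Pair 0 ` (\<lambda>x. inv x) ` R"
      unfolding image_image using sub inv0 by (intro image_cong) auto
    moreover have "{0} \<times> X = Pair (0::int) ` X" for X :: "'a set"
      by auto
    ultimately show ?thesis
      by simp
  qed
  moreover have "(\<lambda>x. inv\<^bsub>Dih G\<^esub> x) ` ({1} \<times> F) = {1} \<times> F"
  proof -
    have "(\<lambda>x. inv\<^bsub>Dih G\<^esub> x) ` Pair 1 ` F = Pair 1 ` F"
      unfolding image_image using sub inv1 by (intro image_cong) auto
    moreover have "{1} \<times> X = Pair (1::int) ` X" for X :: "'a set"
      by auto
    ultimately show ?thesis
      by simp
  qed
  ultimately have invA: "set_inv\<^bsub>Dih G\<^esub> A = {0} \<times> set_inv R \<union> {1} \<times> F"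
    by (subst A) (simp only: image_inv image_Un)
  have un: "(X \<union> Y) <#>\<^bsub>Dih G\<^esub> (Z \<union> W) = (X <#>\<^bsub>Dih G\<^esub> Z) \<union> (X <#>\<^bsub>Dih G\<^esub> W)
      \<union> (Y <#>\<^bsub>Dih G\<^esub> Z) \<union> (Y <#>\<^bsub>Dih G\<^esub> W)" for X Y Z W
    by (auto simp: set_mult_def)
  \<comment> \<open>A flip on the left inverts the second factor; a rotation on the left does not.\<close>
  have blocks: "{0} \<times> X <#>\<^bsub>Dih G\<^esub> {0} \<times> Y = {0} \<times> (X <#> Y)"
    "{0} \<times> X <#>\<^bsub>Dih G\<^esub> {1} \<times> Y = {1} \<times> (X <#> Y)"
    "{1} \<times> X <#>\<^bsub>Dih G\<^esub> {0} \<times> Y = {1} \<times> (X <#> set_inv Y)"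
    "{1} \<times> X <#>\<^bsub>Dih G\<^esub> {1} \<times> Y = {0} \<times> (X <#> set_inv Y)" for X Y
    by (fastforce simp: set_mult_def SET_INV_def mult)+
  show "A <#>\<^bsub>Dih G\<^esub> A =
      {0} \<times> ((R <#> R) \<union> (F <#> set_inv F)) \<union> {1} \<times> ((R <#> F) \<union> (F <#> set_inv R))"
    by (subst (1 2) A) (auto simp: un blocks)
  have "(\<lambda>x. inv (inv x)) ` R = (\<lambda>x. x) ` R"
    using sub by (intro image_cong) auto
  then have "set_inv (set_inv R) = R"
    by (simp add: image_inv image_image)
  moreover have "X <#> Y \<subseteq> Y <#> X" if "X \<subseteq> carrier G" "Y \<subseteq> carrier G" for X Y
  proof
    fix z assume "z \<in> X <#> Y"
    then obtain x y where "x \<in> X" "y \<in> Y" "z = x \<otimes> y"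
      by (auto simp: set_mult_def)
    with that have "z = y \<otimes> x"
      by (auto intro: m_comm)
    with \<open>x \<in> X\<close> \<open>y \<in> Y\<close> show "z \<in> Y <#> X"
      by (auto simp: set_mult_def)
  qed
  then have "F <#> R = R <#> F"
    using sub by blast
  ultimately show "A <#>\<^bsub>Dih G\<^esub> set_inv\<^bsub>Dih G\<^esub> A =
      {0} \<times> ((R <#> set_inv R) \<union> (F <#> set_inv F)) \<union> {1} \<times> (R <#> F)"
    by (subst A, subst invA) (auto simp: un blocks)
qed

text \<open>
  All pairs \<open>(x, x)\<close> give the same difference, so at most \<open>|R| (|R| - 1)\<close> pairs contribute besides the
  identity.
\<close>

lemma card_differences_le:
  assumes "finite R" "R \<subseteq> carrier G"
  shows "card (R <#> set_inv R) + card R \<le> card R * card R + 1"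
proof -
  let ?O = "{(x, y). x \<in> R \<and> y \<in> R \<and> x \<noteq> y}"
  have fin: "finite ?O"
    by (rule finite_subset[of _ "R \<times> R"]) (use assms in auto)
  have "R <#> set_inv R \<subseteq> insert \<one> ((\<lambda>(x, y). x \<otimes> inv y) ` ?O)"
    using assms by (force simp: set_mult_def SET_INV_def image_iff)
  then have "card (R <#> set_inv R) \<le> card (insert \<one> ((\<lambda>(x, y). x \<otimes> inv y) ` ?O))"
    using fin by (intro card_mono) auto
  also have "\<dots> \<le> Suc (card ?O)"
    using fin card_image_le[OF fin, of "\<lambda>(x, y). x \<otimes> inv y"] by (simp add: card_insert_if)
  finally show ?thesis
    using card_offdiagonal[OF assms(1)] by simp
qed

text \<open>
  The sums of unordered pairs of distinct elements of \<open>R\<close> coincide with each other only through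
  repeated sums, and with elements of \<open>F - F\<close> only through sums that are also differences.
\<close>

lemma card_new_rotations_ge:
  assumes "finite R" "finite F" "R \<subseteq> carrier G" "F \<subseteq> carrier G"
  shows "card R * card R \<le> card R + 2 * card ((R <#> R) - (F <#> set_inv F))
    + 2 * card (repeated_sums G R) + 2 * card (sums_as_differences G R F)"
proof -
  obtain P where P: "P \<subseteq> R \<times> R" "\<And>x y. (x, y) \<in> P \<Longrightarrow> (y, x) \<notin> P"
    "2 * card P + card R = card R * card R"
    using half_of_offdiagonal[OF assms(1)] by blast
  let ?f = "\<lambda>(x, y). x \<otimes> y" and ?g = "\<lambda>(a, b). a \<otimes> inv b"
  have finP: "finite P"
    using P assms finite_subset[of P "R \<times> R"] by blast
  have "card P \<le> card (?f ` P - ?g ` (F \<times> F))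
      + card {(p, p'). p \<in> P \<and> p' \<in> P \<and> p \<noteq> p' \<and> ?f p = ?f p'}
      + card {(p, q). p \<in> P \<and> q \<in> F \<times> F \<and> ?f p = ?g q}"
    using assms finP by (intro card_image_diff_ge) auto
  moreover have "card (?f ` P - ?g ` (F \<times> F)) \<le> card ((R <#> R) - (F <#> set_inv F))"
  proof (rule card_mono)
    show "finite ((R <#> R) - (F <#> set_inv F))"
      using assms by (simp add: set_mult_def)
    show "?f ` P - ?g ` (F \<times> F) \<subseteq> (R <#> R) - (F <#> set_inv F)"
      using P(1) by (fastforce simp: set_mult_def SET_INV_def)
  qed
  moreover have "card {(p, p'). p \<in> P \<and> p' \<in> P \<and> p \<noteq> p' \<and> ?f p = ?f p'}
      \<le> card (repeated_sums G R)"
  proof (rule card_inj_on_le[where f = "\<lambda>((x, y), (a, b)). (x, y, a, b)"])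
    show "(\<lambda>((x, y), (a, b)). (x, y, a, b)) `
        {(p, p'). p \<in> P \<and> p' \<in> P \<and> p \<noteq> p' \<and> ?f p = ?f p'} \<subseteq> repeated_sums G R"
      (is "?I \<subseteq> _")
    proof
      fix t assume "t \<in> ?I"
      then obtain x y a b where t: "t = (x, y, a, b)"
        and *: "(x, y) \<in> P" "(a, b) \<in> P" "x = a \<longrightarrow> y \<noteq> b" "x \<otimes> y = a \<otimes> b"
        by auto
      then have mem: "x \<in> R" "y \<in> R" "a \<in> R" "b \<in> R"
        using P by auto
      then have "x \<in> carrier G" "y \<in> carrier G" "a \<in> carrier G" "b \<in> carrier G"
        using assms by auto
      \<comment> \<open>Two pairs with equal sums that share one element share both, and \<open>P\<close> contains no pair
        together with its reverse.\<close>
      then have "x = a \<longleftrightarrow> y = b" "x = b \<longleftrightarrow> y = a"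
        using *(4) by (metis left_cancel right_cancel, metis left_cancel right_cancel m_comm)
      then have "distinct [x, y, a, b]"
        using * P(2) by auto
      with mem *(4) show "t \<in> repeated_sums G R"
        by (simp add: t repeated_sums_def)
    qed
  qed (auto intro!: inj_onI finite_quadruples assms)
  moreover have "card {(p, q). p \<in> P \<and> q \<in> F \<times> F \<and> ?f p = ?g q}
      \<le> card (sums_as_differences G R F)"
  proof (rule card_inj_on_le[where f = "\<lambda>((x, y), (a, b)). (x, y, a, b)"])
    show "(\<lambda>((x, y), (a, b)). (x, y, a, b)) `
        {(p, q). p \<in> P \<and> q \<in> F \<times> F \<and> ?f p = ?g q} \<subseteq> sums_as_differences G R F"
      (is "?I \<subseteq> _")
    proof
      fix t assume "t \<in> ?I"
      then obtain x y a b where t: "t = (x, y, a, b)"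
        and *: "x \<in> R" "y \<in> R" "a \<in> F" "b \<in> F" "x \<otimes> y = a \<otimes> inv b"
        using P(1) by auto
      then have "x \<in> carrier G" "y \<in> carrier G" "a \<in> carrier G" "b \<in> carrier G"
        using assms by auto
      then have "x \<otimes> y \<otimes> b = a"
        unfolding *(5) by (simp add: m_assoc)
      with * show "t \<in> sums_as_differences G R F"
        by (simp add: t sums_as_differences_def)
    qed
  qed (auto intro!: inj_onI finite_quadruples assms)
  ultimately show ?thesis
    using P(3) by linarith
qed

text \<open>
  Each of the \<open>r f\<close> pairs yields a difference \<open>a - x\<close>; it fails to be a new flip only if another pair
  yields the same difference or if \<open>a - x = y + b\<close>, that is \<open>x + y = a - b\<close>.
\<close>

lemma card_new_flips_ge:
  assumes "finite R" "finite F" "R \<subseteq> carrier G" "F \<subseteq> carrier G"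
  shows "card R * card F \<le> card ((F <#> set_inv R) - (R <#> F))
    + card (parallel_pairs G R F) + card (sums_as_differences G R F)"
proof -
  let ?f = "\<lambda>(a, x). a \<otimes> inv x" and ?g = "\<lambda>(y, b). y \<otimes> b"
  have "card (F \<times> R) \<le> card (?f ` (F \<times> R) - ?g ` (R \<times> F))
      + card {(p, p'). p \<in> F \<times> R \<and> p' \<in> F \<times> R \<and> p \<noteq> p' \<and> ?f p = ?f p'}
      + card {(p, q). p \<in> F \<times> R \<and> q \<in> R \<times> F \<and> ?f p = ?g q}"
    using assms by (intro card_image_diff_ge) auto
  moreover have "?f ` (F \<times> R) = F <#> set_inv R"
    unfolding set_mult_def SET_INV_def by auto
  moreover have "?g ` (R \<times> F) = R <#> F"
    unfolding set_mult_def by auto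
  moreover have "card {(p, p'). p \<in> F \<times> R \<and> p' \<in> F \<times> R \<and> p \<noteq> p' \<and> ?f p = ?f p'}
      \<le> card (parallel_pairs G R F)"
  proof (rule card_inj_on_le[where f = "\<lambda>((a, x), (b, y)). (x, y, a, b)"])
    show "(\<lambda>((a, x), (b, y)). (x, y, a, b)) `
        {(p, p'). p \<in> F \<times> R \<and> p' \<in> F \<times> R \<and> p \<noteq> p' \<and> ?f p = ?f p'} \<subseteq> parallel_pairs G R F"
      (is "?I \<subseteq> _")
    proof
      fix t assume "t \<in> ?I"
      then obtain a x b y where t: "t = (x, y, a, b)"
        and *: "a \<in> F" "b \<in> F" "x \<in> R" "y \<in> R" "a = b \<longrightarrow> x \<noteq> y" "a \<otimes> inv x = b \<otimes> inv y"
        by auto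
      then have c: "a \<in> carrier G" "b \<in> carrier G" "x \<in> carrier G" "y \<in> carrier G"
        using assms by auto
      have "a \<otimes> y = a \<otimes> inv x \<otimes> x \<otimes> y"
        using c by (simp add: m_assoc)
      also have "\<dots> = b \<otimes> x"
        unfolding *(6) using c by (simp add: m_ac l_inv_ex)
      finally have eq: "a \<otimes> y = b \<otimes> x" .
      then have "a = b \<longleftrightarrow> x = y"
        using c by (metis left_cancel right_cancel)
      with * eq show "t \<in> parallel_pairs G R F"
        by (auto simp: t parallel_pairs_def)
    qed
  qed (auto intro!: inj_onI finite_quadruples assms)
  moreover have "card {(p, q). p \<in> F \<times> R \<and> q \<in> R \<times> F \<and> ?f p = ?g q}
      \<le> card (sums_as_differences G R F)"
  proof (rule card_inj_on_le[where f = "\<lambda>((a, x), (y, b)). (x, y, a, b)"])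
    show "(\<lambda>((a, x), (y, b)). (x, y, a, b)) `
        {(p, q). p \<in> F \<times> R \<and> q \<in> R \<times> F \<and> ?f p = ?g q} \<subseteq> sums_as_differences G R F"
      (is "?I \<subseteq> _")
    proof
      fix t assume "t \<in> ?I"
      then obtain a x y b where t: "t = (x, y, a, b)"
        and *: "a \<in> F" "b \<in> F" "x \<in> R" "y \<in> R" "a \<otimes> inv x = y \<otimes> b"
        by auto
      then have c: "a \<in> carrier G" "b \<in> carrier G" "x \<in> carrier G" "y \<in> carrier G"
        using assms by auto
      have "x \<otimes> y \<otimes> b = x \<otimes> (a \<otimes> inv x)"
        unfolding *(5) using c by (simp add: m_assoc)
      also have "\<dots> = a"
        using c by (metis inv_closed m_comm inv_solve_right m_closed)
      finally show "t \<in> sums_as_differences G R F"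
        using * by (simp add: t sums_as_differences_def)
    qed
  qed (auto intro!: inj_onI finite_quadruples assms)
  ultimately show ?thesis
    by (simp add: card_cartesian_product mult.commute)
qed

text \<open>
  The common parts \<open>F - F\<close> and \<open>R + F\<close> of the sumset and the difference set cancel, and the previous
  bounds compare what remains: up to coincidences, \<open>r f + (r\<^sup>2 - r) / 2\<close> on the side of sums against
  \<open>r\<^sup>2 - r + 1\<close> on the side of differences. Everything is doubled to stay within the naturals.
\<close>

lemma Dih_sums_vs_differences:
  assumes "finite A" "A \<subseteq> carrier (Dih G)"
  defines "R \<equiv> rotations A" and "F \<equiv> flips A"
  shows "2 * card (A <#>\<^bsub>Dih G\<^esub> set_inv\<^bsub>Dih G\<^esub> A) + 2 * card R * card F + card R \<le>
    2 * card (A <#>\<^bsub>Dih G\<^esub> A) + card R * card R + 2 +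
    2 * (card (parallel_pairs G R F) + 2 * card (sums_as_differences G R F)
      + card (repeated_sums G R))"
proof -
  have arith: "2 * d + 2 * p + k \<le> 2 * s + q + 2 + 2 * (u + 2 * v + w)"
    if "s = x + r + (y + f)" "d \<le> x + e + y" "e + k \<le> q + 1"
      "q \<le> k + 2 * r + 2 * w + 2 * v" "p \<le> f + u + v" for d p k s q u v w x r y f e :: nat
  proof -
    have "2 * e + k \<le> 2 * r + 2 * w + 2 * v + q + 2"
      using that(3,4) by linarith
    moreover have "d + p + r \<le> s + e + u + v"
      using that(1,2,5) by linarith
    ultimately show ?thesis
      by presburger
  qed
  have fin: "finite R" "finite F"
    using assms(1) by (auto simp: R_def F_def slices_as_images)
  have sub: "R \<subseteq> carrier G" "F \<subseteq> carrier G"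
    using assms(2) by (auto simp: R_def F_def rotations_def flips_def Dih_def)
  have finite_mult: "finite (X <#> Y)" if "finite X" "finite Y" for X Y
    using that by (simp add: set_mult_def)
  have finite_inv: "finite (set_inv X)" if "finite X" for X
    using that by (simp add: SET_INV_def)
  note finite = fin finite_mult finite_inv
  have tagged: "card ({0::int} \<times> X \<union> {1} \<times> Y) = card X + card Y" if "finite X" "finite Y"
    for X Y :: "'a set"
    using that by (subst card_Un_disjoint) (auto simp: card_cartesian_product)
  let ?X = "F <#> set_inv F"
  have un: "card (X \<union> Y) = card X + card (Y - X)" "card (Y \<union> X) = card X + card (Y - X)"
    if "finite X" "finite Y" for X Y :: "'a set"
    using that card_Un_disjoint[of X "Y - X"] by (simp_all add: Un_commute)
  have "card (A <#>\<^bsub>Dih G\<^esub> A) = card ?X + card ((R <#> R) - ?X)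
      + (card (R <#> F) + card ((F <#> set_inv R) - (R <#> F)))"
    unfolding Dih_set_mult[OF assms(2)] R_def[symmetric] F_def[symmetric]
    using un[of ?X "R <#> R"] un[of "R <#> F" "F <#> set_inv R"]
    by (simp add: tagged finite)
  moreover have "card (A <#>\<^bsub>Dih G\<^esub> set_inv\<^bsub>Dih G\<^esub> A) \<le>
      card ?X + card (R <#> set_inv R) + card (R <#> F)"
    unfolding Dih_set_mult[OF assms(2)] R_def[symmetric] F_def[symmetric]
    using card_Un_le[of "R <#> set_inv R" ?X] by (simp add: tagged finite)
  ultimately show ?thesis
    using card_differences_le[OF fin(1) sub(1)] card_new_rotations_ge[OF fin sub]
      card_new_flips_ge[OF fin sub]
    unfolding mult.assoc
    by (rule arith)
qed

section \<open>The expected number of coincidences\<close>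

text \<open>
  The weight \<open>2\<close> reflects that a sum which is also a difference can cost an element both among the
  new rotations and among the new flips.
\<close>

definition coincidences :: "(int \<times> 'a) set \<Rightarrow> nat" where
  "coincidences A = card (parallel_pairs G (rotations A) (flips A))
     + 2 * card (sums_as_differences G (rotations A) (flips A))
     + card (repeated_sums G (rotations A))"

text \<open>
  Three of the four elements of a coincidence determine the fourth.
\<close>

lemma card_parallel_pairs_le:
  assumes "finite H" "H \<subseteq> carrier G"
  shows "card (parallel_pairs G H H) \<le> card H ^ 3"
proof -
  have "card (parallel_pairs G H H) \<le> card (H \<times> H \<times> H)"
  proof (rule card_inj_on_le[where f = "\<lambda>(x, y, a, b). (x, y, a)"])
    show "inj_on (\<lambda>(x, y, a, b). (x, y, a)) (parallel_pairs G H H)"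
      using assms(2) by (auto simp: parallel_pairs_def inj_on_def) (metis right_cancel subsetD)
  qed (use assms in \<open>auto simp: parallel_pairs_def\<close>)
  then show ?thesis
    by (simp add: card_cartesian_product power3_eq_cube mult.assoc)
qed

lemma card_repeated_sums_le:
  assumes "finite H" "H \<subseteq> carrier G"
  shows "card (repeated_sums G H) \<le> card H ^ 3"
proof -
  have "card (repeated_sums G H) \<le> card (H \<times> H \<times> H)"
  proof (rule card_inj_on_le[where f = "\<lambda>(x, y, a, b). (x, y, a)"])
    show "inj_on (\<lambda>(x, y, a, b). (x, y, a)) (repeated_sums G H)"
      using assms(2) by (auto simp: repeated_sums_def inj_on_def) (metis left_cancel subsetD)
  qed (use assms in \<open>auto simp: repeated_sums_def\<close>)
  then show ?thesis
    by (simp add: card_cartesian_product power3_eq_cube mult.assoc)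
qed

text \<open>
  The degenerate cases are counted separately because they need fewer elements of \<open>A\<close> and are
  therefore more likely to occur. If \<open>a = b\<close>, the equation becomes \<open>x + y = 0\<close>; if moreover \<open>x = y\<close>, only
  the few solutions of \<open>x + x = 0\<close> remain. This last case is where elements of order at most two enter.
\<close>

lemma card_sums_as_differences_le:
  assumes "finite H" "H \<subseteq> carrier G"
  defines "Q \<equiv> sums_as_differences G H H"
  shows "card {(x, y, a, b). (x, y, a, b) \<in> Q \<and> x \<noteq> y \<and> a \<noteq> b} \<le> card H ^ 3"
    and "card {(x, y, a, b). (x, y, a, b) \<in> Q \<and> x \<noteq> y \<and> a = b} \<le> card H ^ 2"
    and "card {(x, y, a, b). (x, y, a, b) \<in> Q \<and> x = y \<and> a \<noteq> b} \<le> card H ^ 2"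
    and "card {(x, y, a, b). (x, y, a, b) \<in> Q \<and> x = y \<and> a = b}
      \<le> card {x \<in> H. x \<otimes> x = \<one>} * card H"
proof -
  have mem: "x \<in> H" "y \<in> H" "a \<in> H" "b \<in> H" "x \<in> carrier G" "y \<in> carrier G"
      "a \<in> carrier G" "b \<in> carrier G" "x \<otimes> y \<otimes> b = a"
    if "(x, y, a, b) \<in> Q" for x y a b
    using that assms(2) by (auto simp: Q_def sums_as_differences_def)
  have same: "x \<otimes> y = \<one>" if "(x, y, a, a) \<in> Q" for x y a
    using mem[OF that] by (metis m_closed r_cancel_one)
  have "card {(x, y, a, b). (x, y, a, b) \<in> Q \<and> x \<noteq> y \<and> a \<noteq> b} \<le> card (H \<times> H \<times> H)"
  proof (rule card_inj_on_le[where f = "\<lambda>(x, y, a, b). (x, y, b)"])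
    show "inj_on (\<lambda>(x, y, a, b). (x, y, b)) {(x, y, a, b). (x, y, a, b) \<in> Q \<and> x \<noteq> y \<and> a \<noteq> b}"
      by (auto simp: inj_on_def dest!: mem(9))
  qed (use assms mem in auto)
  then show "card {(x, y, a, b). (x, y, a, b) \<in> Q \<and> x \<noteq> y \<and> a \<noteq> b} \<le> card H ^ 3"
    by (simp add: card_cartesian_product power3_eq_cube mult.assoc)
  have "card {(x, y, a, b). (x, y, a, b) \<in> Q \<and> x \<noteq> y \<and> a = b} \<le> card (H \<times> H)"
  proof (rule card_inj_on_le[where f = "\<lambda>(x, y, a, b). (x, a)"])
    show "inj_on (\<lambda>(x, y, a, b). (x, a)) {(x, y, a, b). (x, y, a, b) \<in> Q \<and> x \<noteq> y \<and> a = b}"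
    proof -
      have "y = y'" if "(x, y, a, a) \<in> Q" "(x, y', a, a) \<in> Q" for x y y' a
        using same[OF that(1)] same[OF that(2)] mem[OF that(1)] mem[OF that(2)]
        by (metis left_cancel)
      then show ?thesis
        by (auto simp: inj_on_def)
    qed
  qed (use assms mem in auto)
  then show "card {(x, y, a, b). (x, y, a, b) \<in> Q \<and> x \<noteq> y \<and> a = b} \<le> card H ^ 2"
    by (simp add: card_cartesian_product power2_eq_square)
  have "card {(x, y, a, b). (x, y, a, b) \<in> Q \<and> x = y \<and> a \<noteq> b} \<le> card (H \<times> H)"
  proof (rule card_inj_on_le[where f = "\<lambda>(x, y, a, b). (x, b)"])
    show "inj_on (\<lambda>(x, y, a, b). (x, b)) {(x, y, a, b). (x, y, a, b) \<in> Q \<and> x = y \<and> a \<noteq> b}"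
      by (auto simp: inj_on_def dest!: mem(9))
  qed (use assms mem in auto)
  then show "card {(x, y, a, b). (x, y, a, b) \<in> Q \<and> x = y \<and> a \<noteq> b} \<le> card H ^ 2"
    by (simp add: card_cartesian_product power2_eq_square)
  have "card {(x, y, a, b). (x, y, a, b) \<in> Q \<and> x = y \<and> a = b}
      \<le> card ({x \<in> H. x \<otimes> x = \<one>} \<times> H)"
  proof (rule card_inj_on_le[where f = "\<lambda>(x, y, a, b). (x, a)"])
    show "inj_on (\<lambda>(x, y, a, b). (x, a)) {(x, y, a, b). (x, y, a, b) \<in> Q \<and> x = y \<and> a = b}"
      by (auto simp: inj_on_def)
  qed (use assms mem same in auto)
  then show "card {(x, y, a, b). (x, y, a, b) \<in> Q \<and> x = y \<and> a = b}
      \<le> card {x \<in> H. x \<otimes> x = \<one>} * card H"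
    by (simp add: card_cartesian_product)
qed

text \<open>
  The leading term comes from coincidences among four distinct elements: they have total weight
  \<open>1 + 2 + 1\<close>, there are at most \<open>n\<^sup>3\<close> of each kind, and \<open>4 n\<^sup>3 (m / 2 n)\<^sup>4 = m\<^sup>4 / 4 n\<close>. The other two terms
  come from sums that are differences with three and with two distinct elements.
\<close>

lemma expected_coincidences_le:
  assumes "finite H" "H \<subseteq> carrier G" "H \<noteq> {}" "m \<le> 2 * card H"
  defines "n \<equiv> real (card H)" and "\<tau> \<equiv> real (card {x \<in> H. x \<otimes> x = \<one>})"
  shows "(\<Sum>A\<in>subsets_of_size ({0, 1} \<times> H) m. real (coincidences A)) \<le>
    (real m ^ 4 / (4 * n) + real m ^ 3 / (2 * n) + \<tau> * real m ^ 2 / (2 * n))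
      * real ((2 * card H) choose m)"
proof -
  let ?B = "{0::int, 1} \<times> H"
  let ?S = "subsets_of_size ?B m"
  let ?Q = "sums_as_differences G H H"
  let ?U = "\<lambda>(x, y, a, b). {(0::int, x), (0, y), (1, a), (1, b)}"
  let ?V = "\<lambda>(x, y, a, b). {(0::int, x), (0, y), (0, a), (0, b)}"
  let ?Q1 = "{(x, y, a, b). (x, y, a, b) \<in> ?Q \<and> x \<noteq> y \<and> a \<noteq> b}"
  let ?Q2 = "{(x, y, a, b). (x, y, a, b) \<in> ?Q \<and> x \<noteq> y \<and> a = b}"
  let ?Q3 = "{(x, y, a, b). (x, y, a, b) \<in> ?Q \<and> x = y \<and> a \<noteq> b}"
  let ?Q4 = "{(x, y, a, b). (x, y, a, b) \<in> ?Q \<and> x = y \<and> a = b}"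
  let ?N = "\<lambda>U I A. real (card {i \<in> I. U i \<subseteq> A})"
  let ?p = "real m / (2 * n)" and ?C = "real ((2 * card H) choose m)"
  have finB: "finite ?B" and cardB: "card ?B = 2 * card H"
    using assms(1) by (auto simp: card_cartesian_product)
  have n: "n > 0"
    using assms by (simp add: n_def card_gt_0_iff)
  have finQ: "finite (parallel_pairs G H H)" "finite ?Q" "finite (repeated_sums G H)"
    using finite_quadruples assms(1) by auto
  have finQ': "finite ?Q1" "finite ?Q2" "finite ?Q3" "finite ?Q4"
    by (rule finite_subset[OF _ finQ(2)]; auto)+
  have expect: "(\<Sum>A\<in>?S. ?N U I A) \<le> real c * ?p ^ t * ?C"
    if "finite I" "card I \<le> c" "\<And>i. i \<in> I \<Longrightarrow> U i \<subseteq> ?B \<and> card (U i) = t" for U t c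
      and I :: "('a \<times> 'a \<times> 'a \<times> 'a) set"
  proof -
    have "(\<Sum>A\<in>?S. ?N U I A) \<le> real (card I) * ?p ^ t * ?C"
      using expected_configurations_le[OF finB _ that(1,3), of m] assms(4)
      unfolding cardB by (simp add: n_def)
    also have "\<dots> \<le> real c * ?p ^ t * ?C"
      using that(2) n by (intro mult_right_mono) auto
    finally show ?thesis .
  qed
  have pointwise: "real (coincidences A) \<le> ?N ?U (parallel_pairs G H H) A
      + 2 * (?N ?U ?Q1 A + ?N ?U ?Q2 A + ?N ?U ?Q3 A + ?N ?U ?Q4 A) + ?N ?V (repeated_sums G H) A"
    if "A \<in> ?S" for A
  proof -
    have A: "A \<subseteq> ?B"
      using that by (simp add: subsets_of_size_def)
    have "parallel_pairs G (rotations A) (flips A) = {i \<in> parallel_pairs G H H. ?U i \<subseteq> A}"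
      using A by (auto simp: parallel_pairs_def rotations_def flips_def)
    moreover have "repeated_sums G (rotations A) = {i \<in> repeated_sums G H. ?V i \<subseteq> A}"
      using A by (auto simp: repeated_sums_def rotations_def)
    moreover have "card (sums_as_differences G (rotations A) (flips A)) \<le>
        card {i \<in> ?Q1. ?U i \<subseteq> A} + card {i \<in> ?Q2. ?U i \<subseteq> A} + card {i \<in> ?Q3. ?U i \<subseteq> A}
          + card {i \<in> ?Q4. ?U i \<subseteq> A}"
    proof -
      have "sums_as_differences G (rotations A) (flips A) = {i \<in> ?Q. ?U i \<subseteq> A}"
        using A by (auto simp: sums_as_differences_def rotations_def flips_def)
      also have "\<dots> = {i \<in> ?Q1 \<union> ?Q2 \<union> ?Q3 \<union> ?Q4. ?U i \<subseteq> A}"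
        by (rule arg_cong[where f = "\<lambda>X. {i \<in> X. ?U i \<subseteq> A}"]) auto
      finally show ?thesis
        using card_filter_Un4_le by (simp only:)
    qed
    ultimately show ?thesis
      by (simp add: coincidences_def)
  qed
  have "(\<Sum>A\<in>?S. real (coincidences A)) \<le> (\<Sum>A\<in>?S. ?N ?U (parallel_pairs G H H) A
      + 2 * (?N ?U ?Q1 A + ?N ?U ?Q2 A + ?N ?U ?Q3 A + ?N ?U ?Q4 A) + ?N ?V (repeated_sums G H) A)"
    by (intro sum_mono pointwise)
  also have "\<dots> = (\<Sum>A\<in>?S. ?N ?U (parallel_pairs G H H) A)
      + 2 * ((\<Sum>A\<in>?S. ?N ?U ?Q1 A) + (\<Sum>A\<in>?S. ?N ?U ?Q2 A) + (\<Sum>A\<in>?S. ?N ?U ?Q3 A)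
        + (\<Sum>A\<in>?S. ?N ?U ?Q4 A)) + (\<Sum>A\<in>?S. ?N ?V (repeated_sums G H) A)"
    by (simp only: sum.distrib flip: sum_distrib_left)
  also have "\<dots> \<le> real (card H ^ 3) * ?p ^ 4 * ?C
      + 2 * (real (card H ^ 3) * ?p ^ 4 * ?C + real (card H ^ 2) * ?p ^ 3 * ?C
        + real (card H ^ 2) * ?p ^ 3 * ?C
        + real (card {x \<in> H. x \<otimes> x = \<one>} * card H) * ?p ^ 2 * ?C)
      + real (card H ^ 3) * ?p ^ 4 * ?C"
    using card_sums_as_differences_le[OF assms(1,2)]
    by (intro add_mono mult_left_mono expect finQ finQ'
        card_parallel_pairs_le card_repeated_sums_le assms(1,2))
      (auto simp: parallel_pairs_def repeated_sums_def sums_as_differences_def card_insert_if)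
  also have "\<dots> = (real m ^ 4 / (4 * n) + real m ^ 3 / (2 * n) + \<tau> * real m ^ 2 / (2 * n)) * ?C"
    using n by (simp add: n_def[symmetric] \<tau>_def[symmetric] field_simps power_divide
        eval_nat_numeral)
  finally show ?thesis .
qed

text \<open>
  With \<open>r = m / 2 + u\<close> and \<open>|u| \<le> m / 8\<close> one has
  \<open>2 r f - r\<^sup>2 = m\<^sup>2 / 4 - m u - 3 u\<^sup>2 \<ge> (5 / 64) m\<^sup>2\<close>, which exceeds twice the number of coincidences; the
  remaining \<open>r - 2\<close> is positive because \<open>r \<ge> 3 m / 8\<close> and \<open>m \<ge> 6\<close>.
\<close>

lemma MSTD_if_balanced:
  assumes "finite H" "H \<subseteq> carrier G" "A \<in> subsets_of_size ({0, 1} \<times> H) m" "m \<ge> 6"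
    and balanced: "\<bar>real (card (rotations A)) - real (card (flips A))\<bar> < real m / 4"
    and few: "real (coincidences A) < real m ^ 2 / 32"
  shows "MSTD (Dih G) A"
proof -
  have A: "A \<subseteq> {0, 1} \<times> H" "card A = m"
    using assms(3) by (auto simp: subsets_of_size_def)
  then have "finite A"
    using assms(1) finite_subset by blast
  define r f where "r = real (card (rotations A))" and "f = real (card (flips A))"
  let ?s = "real (card (A <#>\<^bsub>Dih G\<^esub> A))" and ?d = "real (card (A <#>\<^bsub>Dih G\<^esub> set_inv\<^bsub>Dih G\<^esub> A))"
  have rf: "r + f = real m"
    using card_slices(1)[OF A(1) \<open>finite A\<close>] A(2) by (simp add: r_def f_def)
  have "A \<subseteq> carrier (Dih G)"
    using A(1) assms(2) by (auto simp: Dih_def carrier_integer_mod_group)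
  then have "real (2 * card (A <#>\<^bsub>Dih G\<^esub> set_inv\<^bsub>Dih G\<^esub> A)
        + 2 * card (rotations A) * card (flips A) + card (rotations A)) \<le>
      real (2 * card (A <#>\<^bsub>Dih G\<^esub> A) + card (rotations A) * card (rotations A) + 2
        + 2 * coincidences A)"
    using Dih_sums_vs_differences[OF \<open>finite A\<close>]
    unfolding coincidences_def of_nat_le_iff by blast
  then have main: "2 * ?d + 2 * r * f + r \<le> 2 * ?s + r * r + 2 + 2 * real (coincidences A)"
    by (simp add: r_def f_def)
  define u where "u = r - real m / 2"
  have u: "\<bar>u\<bar> \<le> real m / 8"
    using balanced[folded r_def f_def] rf unfolding u_def by linarith
  have r: "r = real m / 2 + u" and f: "f = real m / 2 - u"
    using rf by (auto simp: u_def)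
  have "real m * u \<le> real m * (real m / 8)"
    using u by (intro mult_left_mono) auto
  moreover have "u * u \<le> (real m / 8) * (real m / 8)"
    using mult_mono[OF u u] by simp
  ultimately have "5 / 64 * (real m * real m) \<le> 2 * r * f - r * r"
    unfolding r f by (simp add: algebra_simps)
  moreover have "r > 2"
    using u assms(4) by (simp add: r)
  ultimately have "?d < ?s"
    using main few by (simp add: power2_eq_square)
  then show ?thesis
    by (simp add: MSTD_def)
qed

text \<open>
  A set that is not MSTD is either unbalanced, which Chebyshev's inequality bounds by the first term, or
  has at least \<open>m\<^sup>2 / 32\<close> coincidences, which Markov's inequality bounds by the second.
\<close>

lemma few_non_MSTD:
  assumes "finite H" "H \<subseteq> carrier G" "H \<noteq> {}" "6 \<le> m" "m \<le> 2 * card H"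
    and "card {x \<in> H. x \<otimes> x = \<one>} \<le> j" "1 \<le> j"
  shows "real (card {A \<in> subsets_of_size ({0, 1} \<times> H) m. \<not> MSTD (Dih G) A}) \<le>
    (16 / real m + 40 * real j * real m ^ 2 / real (card H)) * real ((2 * card H) choose m)"
proof -
  let ?B = "{0::int, 1} \<times> H"
  let ?S = "subsets_of_size ?B m" and ?C = "real ((2 * card H) choose m)"
  let ?D = "\<lambda>A. (real (card (rotations A)) - real (card (flips A)))\<^sup>2"
  let ?n = "real (card H)"
  have finB: "finite ?B" and cardB: "card ?B = 2 * card H"
    using assms(1) by (auto simp: card_cartesian_product)
  have finS: "finite ?S"
    using finB finite_subsets_of_size by blast
  have n: "?n > 0"
    using assms by (simp add: card_gt_0_iff)
  have unbalanced: "real (card {A \<in> ?S. real m ^ 2 / 16 \<le> ?D A}) \<le> 16 / real m * ?C"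
  proof -
    \<comment> \<open>The difference \<open>r - f\<close> is the sum over \<open>A\<close> of the sign that is \<open>1\<close> on rotations and \<open>-1\<close> on flips.\<close>
    let ?s = "\<lambda>p::int \<times> 'a. if fst p = 0 then 1 else - 1 :: real"
    have "real m ^ 2 / 16 * real (card {A \<in> ?S. real m ^ 2 / 16 \<le> ?D A}) \<le> (\<Sum>A\<in>?S. ?D A)"
      using finS by (rule markov_count) simp
    also have "\<dots> = (\<Sum>A\<in>?S. (sum ?s A)\<^sup>2)"
    proof (intro sum.cong refl)
      fix A assume "A \<in> ?S"
      then have "A \<subseteq> ?B"
        by (simp add: subsets_of_size_def)
      then show "?D A = (sum ?s A)\<^sup>2"
        using card_slices(2)[of A H] finB finite_subset by metis
    qed
    also have "\<dots> \<le> real m * real (card ?B choose m)"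
    proof (rule sum_square_le)
      show "sum ?s ?B = 0"
        using card_slices(2)[of ?B H] finB by (simp add: rotations_def flips_def)
    qed (use assms finB cardB in auto)
    finally show ?thesis
      unfolding cardB using assms(4) by (simp add: field_simps power2_eq_square)
  qed
  have crowded: "real (card {A \<in> ?S. real m ^ 2 / 32 \<le> real (coincidences A)}) \<le>
      40 * real j * real m ^ 2 / ?n * ?C"
  proof -
    let ?\<tau> = "real (card {x \<in> H. x \<otimes> x = \<one>})"
    have "real m ^ 2 / 32 * real (card {A \<in> ?S. real m ^ 2 / 32 \<le> real (coincidences A)})
        \<le> (\<Sum>A\<in>?S. real (coincidences A))"
      using finS by (rule markov_count) simp
    also have "\<dots> \<le> (real m ^ 4 / (4 * ?n) + real m ^ 3 / (2 * ?n) + ?\<tau> * real m ^ 2 / (2 * ?n)) * ?C"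
      using expected_coincidences_le[OF assms(1-3,5)] .
    also have "\<dots> \<le> (5 / 4 * real j * real m ^ 4 / ?n) * ?C"
    proof (rule mult_right_mono)
      have m: "1 \<le> real m"
        using assms(4) by simp
      have "real m ^ 4 \<le> real j * real m ^ 4"
        using assms(7) by (simp add: mult_le_cancel_right1)
      moreover have "real m ^ 3 \<le> real m ^ 4"
        using m by (intro power_increasing) auto
      moreover have "?\<tau> * real m ^ 2 \<le> real j * real m ^ 4"
        using m assms(6) by (intro mult_mono power_increasing) auto
      ultimately have "real m ^ 4 / 4 + real m ^ 3 / 2 + ?\<tau> * real m ^ 2 / 2 \<le> 5 / 4 * real j * real m ^ 4"
        by linarith
      then have "(real m ^ 4 / 4 + real m ^ 3 / 2 + ?\<tau> * real m ^ 2 / 2) / ?n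
          \<le> (5 / 4 * real j * real m ^ 4) / ?n"
        using n by (intro divide_right_mono) auto
      then show "real m ^ 4 / (4 * ?n) + real m ^ 3 / (2 * ?n) + ?\<tau> * real m ^ 2 / (2 * ?n)
          \<le> 5 / 4 * real j * real m ^ 4 / ?n"
        by (simp add: add_divide_distrib)
    qed simp
    finally have "real m ^ 2 / 32 * real (card {A \<in> ?S. real m ^ 2 / 32 \<le> real (coincidences A)})
        \<le> real m ^ 2 / 32 * (40 * real j * real m ^ 2 / ?n * ?C)"
      by (simp add: field_simps power2_eq_square power4_eq_xxxx)
    moreover have "real m ^ 2 / 32 > 0"
      using assms(4) by simp
    ultimately show ?thesis
      using mult_le_cancel_left_pos by blast
  qed
  have "{A \<in> ?S. \<not> MSTD (Dih G) A} \<subseteq>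
      {A \<in> ?S. real m ^ 2 / 16 \<le> ?D A} \<union> {A \<in> ?S. real m ^ 2 / 32 \<le> real (coincidences A)}"
  proof clarify
    fix A assume A: "A \<in> ?S" "\<not> MSTD (Dih G) A" "\<not> real m ^ 2 / 32 \<le> real (coincidences A)"
    then have "real m / 4 \<le> \<bar>real (card (rotations A)) - real (card (flips A))\<bar>"
      using MSTD_if_balanced[OF assms(1,2) A(1) assms(4)] by force
    then have "(real m / 4)\<^sup>2 \<le> ?D A"
      by (metis abs_le_square_iff abs_of_nonneg divide_nonneg_nonneg of_nat_0_le_iff zero_le_numeral)
    then show "real m ^ 2 / 16 \<le> ?D A"
      by (simp add: power_divide)
  qed
  then have "card {A \<in> ?S. \<not> MSTD (Dih G) A} \<le>
      card ({A \<in> ?S. real m ^ 2 / 16 \<le> ?D A} \<union> {A \<in> ?S. real m ^ 2 / 32 \<le> real (coincidences A)})"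
    using finS by (intro card_mono) auto
  also have "\<dots> \<le> card {A \<in> ?S. real m ^ 2 / 16 \<le> ?D A} + card {A \<in> ?S. real m ^ 2 / 32 \<le> real (coincidences A)}"
    by (rule card_Un_le)
  finally show ?thesis
    using unbalanced crowded by (simp add: distrib_right)
qed

end

section \<open>Boxes in finitely generated abelian groups\<close>

text \<open>
  Residues are represented by the integers \<open>0, \<dots>, \<alpha> - 1\<close>, so the box in \<open>G\<close> and the group \<open>G'\<close> have
  literally the same elements. The group \<open>G'\<close> serves here only as a set; sums are taken in \<open>G\<close>.
\<close>

lemma Dih_box_eq:
  assumes "\<alpha> > 0"
  shows "Dih_box \<alpha> k r q = {0, 1} \<times> carrier (reduced_group \<alpha> k r q)"
    and "carrier (reduced_group \<alpha> k r q) \<subseteq> carrier (fg_group k r q)"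
proof -
  have reduced: "g \<in> carrier (reduced_group \<alpha> k r q) \<longleftrightarrow>
      g \<in> carrier (fg_group k r q) \<and> (\<forall>b\<in>{1..r 0}. 0 \<le> g (0, b) \<and> g (0, b) < int \<alpha>)" for g
  proof -
    have coordinatewise: "(\<forall>i\<in>coord_index k r. P i) \<longleftrightarrow> (\<forall>a\<le>k. \<forall>b\<in>{1..r a}. P (a, b))" for P
      by (auto simp: coord_index_def)
    have "g (a, b) \<in> carrier (if a = 0 then integer_mod_group \<alpha> else integer_mod_group (q a)) \<longleftrightarrow>
        g (a, b) \<in> carrier (if a = 0 then integer_group else integer_mod_group (q a)) \<and>
        (a = 0 \<longrightarrow> 0 \<le> g (0, b) \<and> g (0, b) < int \<alpha>)" for a b
      using assms by (auto simp: carrier_integer_mod_group)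
    then show ?thesis
      unfolding reduced_group_def fg_group_def direct_sum_def carrier_product_group PiE_iff
        coordinatewise by auto
  qed
  show "carrier (reduced_group \<alpha> k r q) \<subseteq> carrier (fg_group k r q)"
    using reduced by blast
  have "{0..<2} = {0, 1 :: int}"
    by auto
  then show "Dih_box \<alpha> k r q = {0, 1} \<times> carrier (reduced_group \<alpha> k r q)"
    unfolding Dih_box_def set_eq_iff by (auto simp: reduced Dih_def carrier_integer_mod_group)
qed

lemma finite_reduced_group:
  assumes "\<forall>a\<in>{1..k}. primepow (q a)" "\<alpha> > 0"
  shows "finite (carrier (reduced_group \<alpha> k r q))"
proof -
  have "finite (coord_index k r)"
    by (simp add: coord_index_def)
  moreover have "a = 0" if "a \<le> k" "q a = 0" for a
  proof (rule ccontr)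
    assume "a \<noteq> 0"
    then have "q a > 0"
      using assms(1) that(1) by (intro primepow_gt_0_nat) auto
    then show False
      using that(2) by simp
  qed
  ultimately show ?thesis
    using assms(2) unfolding reduced_group_def direct_sum_def carrier_product_group
    by (intro finite_PiE) (auto simp: coord_index_def carrier_integer_mod_group)
qed

text \<open>
  Reduction of the free coordinates modulo \<open>\<alpha>\<close> is a homomorphism that is the identity on the box, so a
  solution of \<open>x + x = 0\<close> in \<open>G\<close> is also one in \<open>G'\<close>.
\<close>

lemma involutions_in_box:
  assumes "\<alpha> > 0"
  shows "{x \<in> carrier (reduced_group \<alpha> k r q). x \<otimes>\<^bsub>fg_group k r q\<^esub> x = \<one>\<^bsub>fg_group k r q\<^esub>} \<subseteq>
    {x \<in> carrier (reduced_group \<alpha> k r q). group.ord (reduced_group \<alpha> k r q) x \<in> {1, 2}}"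
    (is "?L \<subseteq> ?J")
proof
  let ?R = "reduced_group \<alpha> k r q"
  fix x assume "x \<in> ?L"
  then have x: "x \<in> carrier ?R" "x \<otimes>\<^bsub>fg_group k r q\<^esub> x = \<one>\<^bsub>fg_group k r q\<^esub>"
    by auto
  interpret R: comm_group ?R
    unfolding reduced_group_def by (intro comm_group_direct_sum) simp
  have "x (a, b) \<otimes>\<^bsub>if a = 0 then integer_mod_group \<alpha> else integer_mod_group (q a)\<^esub> x (a, b) =
      \<one>\<^bsub>if a = 0 then integer_mod_group \<alpha> else integer_mod_group (q a)\<^esub>"
    if "(a, b) \<in> coord_index k r" for a b
    using fun_cong[OF x(2), of "(a, b)"] that
    by (cases "a = 0") (auto simp: fg_group_def direct_sum_def)
  then have "x \<otimes>\<^bsub>?R\<^esub> x = \<one>\<^bsub>?R\<^esub>"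
    unfolding reduced_group_def direct_sum_def mult_product_group one_product_group
    by (intro restrict_ext) (simp only: split_paired_all prod.case)
  then have "x [^]\<^bsub>?R\<^esub> (2::nat) = \<one>\<^bsub>?R\<^esub>"
    using x(1) by (simp add: numeral_2_eq_2)
  then have "R.ord x dvd 2"
    using x(1) R.pow_eq_id by blast
  then have "R.ord x \<in> {1, 2}"
    using prime_nat_iff two_is_prime_nat by auto
  with x(1) show "x \<in> ?J"
    by simp
qed

theorem corollary3p8:
  shows "\<forall>\<epsilon>::real. \<epsilon> > 0 \<longrightarrow>
    (\<exists>m\<^sub>\<epsilon>::nat. \<forall>j::nat. j > 0 \<longrightarrow>
      (\<exists>c::real. c > 0 \<and>
        (\<forall>(k::nat) (r::nat \<Rightarrow> nat) (q::nat \<Rightarrow> nat) (\<alpha>::nat) (n::nat) (m::nat).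
          (\<forall>a\<in>{1..k}. primepow (q a)) \<longrightarrow>
          \<alpha> > 0 \<longrightarrow>
          n = order (reduced_group \<alpha> k r q) \<longrightarrow>
          j = card {x \<in> carrier (reduced_group \<alpha> k r q).
                      group.ord (reduced_group \<alpha> k r q) x \<in> {1, 2}} \<longrightarrow>
          m\<^sub>\<epsilon> \<le> m \<longrightarrow>
          real m \<le> c * sqrt (real n) \<longrightarrow>
          proportion (MSTD (Dih (fg_group k r q))) {A. A \<subseteq> Dih_box \<alpha> k r q \<and> card A = m}
            \<ge> 1 - \<epsilon>)))"
proof -
  show ?thesis
    (is "\<forall>\<epsilon>. \<epsilon> > 0 \<longrightarrow> (\<exists>m\<^sub>\<epsilon>. \<forall>j. j > 0 \<longrightarrow> (\<exists>c. c > 0 \<and> ?P \<epsilon> m\<^sub>\<epsilon> j c))")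
  proof (intro allI impI)
    fix \<epsilon> :: real assume \<epsilon>: "\<epsilon> > 0"
    \<comment> \<open>\<open>M\<close> makes \<open>16 / m \<le> \<epsilon> / 2\<close>, and \<open>c\<close> below makes \<open>40 j m\<^sup>2 / n \<le> \<epsilon> / 2\<close>. The bound \<open>c \<le> 1\<close> also
      ensures \<open>m \<le> n\<close>, so that subsets of size \<open>m\<close> exist and the proportion is not \<open>0 / 0\<close>.\<close>
    define M where "M = max 6 (nat \<lceil>32 / \<epsilon>\<rceil>)"
    have "\<exists>c. c > 0 \<and> ?P \<epsilon> M j c" if j: "j > 0" for j
    proof -
      define c where "c = min 1 (sqrt (\<epsilon> / (80 * real j)))"
      have c: "0 < c" "c \<le> 1"
        using \<epsilon> j by (auto simp: c_def)
      have "c\<^sup>2 \<le> (sqrt (\<epsilon> / (80 * real j)))\<^sup>2"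
        using c by (intro power_mono) (auto simp: c_def)
      also have "\<dots> = \<epsilon> / (80 * real j)"
        using \<epsilon> by simp
      finally have c2: "c\<^sup>2 \<le> \<epsilon> / (80 * real j)" .
      have "?P \<epsilon> M j c"
      proof (intro allI impI)
        fix k :: nat and r q :: "nat \<Rightarrow> nat" and \<alpha> n m :: nat
        assume q: "\<forall>a\<in>{1..k}. primepow (q a)" and \<alpha>: "\<alpha> > 0"
          and n: "n = order (reduced_group \<alpha> k r q)"
          and jcard: "j = card {x \<in> carrier (reduced_group \<alpha> k r q).
                        group.ord (reduced_group \<alpha> k r q) x \<in> {1, 2}}"
          and Mm: "M \<le> m" and mc: "real m \<le> c * sqrt (real n)"
        let ?H = "carrier (reduced_group \<alpha> k r q)" and ?G = "fg_group k r q"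
        let ?S = "subsets_of_size ({0::int, 1} \<times> ?H) m"
        interpret G: comm_group ?G
          unfolding fg_group_def by (intro comm_group_direct_sum abelian_integer_group)
        have finH: "finite ?H"
          using finite_reduced_group[OF q \<alpha>] .
        have cardH: "card ?H = n"
          by (simp add: n order_def)
        have m: "6 \<le> m" "32 / \<epsilon> \<le> real m"
          using Mm by (auto simp: M_def)
        have sqrt: "real m \<le> sqrt (real n)"
          using mc c mult_right_mono[of c 1 "sqrt (real n)"] by simp
        have npos: "n > 0"
          using sqrt m(1) by (cases "n = 0") auto
        have m2: "real m ^ 2 \<le> real n"
          using sqrt by (metis of_nat_0_le_iff power_mono real_sqrt_pow2)
        have mn: "m \<le> 2 * card ?H"
        proof -
          have "m \<le> m ^ 2"
            using m(1) by (simp add: power2_eq_square)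
          also have "\<dots> \<le> n"
            using m2 by (metis of_nat_le_iff of_nat_power)
          finally show ?thesis
            by (simp add: cardH)
        qed
        have "card {x \<in> ?H. x \<otimes>\<^bsub>?G\<^esub> x = \<one>\<^bsub>?G\<^esub>} \<le> j"
          unfolding jcard using finH by (intro card_mono involutions_in_box \<alpha>) auto
        then have few: "real (card {A \<in> ?S. \<not> MSTD (Dih ?G) A}) \<le>
            (16 / real m + 40 * real j * real m ^ 2 / real n) * real ((2 * n) choose m)"
          using G.few_non_MSTD[of ?H m j] finH Dih_box_eq(2)[OF \<alpha>] npos m(1) mn j cardH by force
        have "16 / real m \<le> \<epsilon> / 2"
          using m \<epsilon> by (simp add: field_simps)
        moreover have "40 * real j * real m ^ 2 / real n \<le> \<epsilon> / 2"
        proof -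
          have "real m ^ 2 \<le> (c * sqrt (real n)) ^ 2"
            using mc by (intro power_mono) auto
          also have "\<dots> = c\<^sup>2 * real n"
            by (simp add: power_mult_distrib)
          also have "\<dots> \<le> \<epsilon> / (80 * real j) * real n"
            using c2 by (intro mult_right_mono) auto
          finally show ?thesis
            using j npos by (simp add: field_simps)
        qed
        ultimately have "(16 / real m + 40 * real j * real m ^ 2 / real n) * real ((2 * n) choose m)
            \<le> \<epsilon> * real ((2 * n) choose m)"
          by (intro mult_right_mono) auto
        with few have bad: "real (card {A \<in> ?S. \<not> MSTD (Dih ?G) A}) \<le> \<epsilon> * real ((2 * n) choose m)"
          by linarith
        have cardS: "card ?S = (2 * n) choose m"
          using finH by (simp add: card_subsets_of_size card_cartesian_product cardH mult_2)
        have finS: "finite ?S"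
          using finH by (simp add: finite_subsets_of_size)
        have pos: "real (card ?S) > 0"
          unfolding cardS using mn by (simp add: cardH)
        have "card ({A \<in> ?S. MSTD (Dih ?G) A} \<union> {A \<in> ?S. \<not> MSTD (Dih ?G) A}) =
            card {A \<in> ?S. MSTD (Dih ?G) A} + card {A \<in> ?S. \<not> MSTD (Dih ?G) A}"
          using finS by (intro card_Un_disjoint) auto
        moreover have "{A \<in> ?S. MSTD (Dih ?G) A} \<union> {A \<in> ?S. \<not> MSTD (Dih ?G) A} = ?S"
          by blast
        ultimately have "(1 - \<epsilon>) * real (card ?S) \<le> real (card {A \<in> ?S. MSTD (Dih ?G) A})"
          using bad[folded cardS] by (simp add: algebra_simps)
        then have "1 - \<epsilon> \<le> proportion (MSTD (Dih ?G)) ?S"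
          using pos by (simp add: proportion_def pos_le_divide_eq)
        then show "proportion (MSTD (Dih ?G)) {A. A \<subseteq> Dih_box \<alpha> k r q \<and> card A = m} \<ge> 1 - \<epsilon>"
          unfolding subsets_of_size_def Dih_box_eq(1)[OF \<alpha>] .
      qed
      with c(1) show ?thesis
        by blast
    qed
    then show "\<exists>m\<^sub>\<epsilon>. \<forall>j. j > 0 \<longrightarrow> (\<exists>c. c > 0 \<and> ?P \<epsilon> m\<^sub>\<epsilon> j c)"
      by blast
  qed
qed

end
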